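(* For every $a\in\mathbb{C}$ with $\tfrac54-\tfrac12a\notin\{0,-1,-2,\dots\}$, $$F\!\left(1-a,\tfrac54-\tfrac32a;\tfrac54-\tfrac12a;-7+4\sqrt3\right)=\frac{2^{2a-2}\,(2-\sqrt3)^{3a/2-5/4}\,\Gamma(\tfrac13)\,\Gamma(\tfrac54-\tfrac12a)}{3^{5/8-3a/4}\,\sqrt{\pi}\;\Gamma(\tfrac{13}{12}-\tfrac12a)}.$$
   Context: $F(a,b;c;x)=\sum_{n\ge0}\frac{(a,n)(b,n)}{(c,n)(1,n)}x^n$ with $(\alpha,n)=\Gamma(\alpha+n)/\Gamma(\alpha)$ is the Gauss hypergeometric series. For $t>0$ and $s\in\mathbb{C}$, $t^s=e^{s\log t}$ with real logarithm. $1/\Gamma$ is interpreted as $0$ at the poles of $\Gamma$. *)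

theory Defs
  imports "HOL-Analysis.Analysis"
begin

text \<open>
  The symbol \<open>(\<alpha>, n) = \<Gamma>(\<alpha> + n) / \<Gamma>(\<alpha>)\<close> is rendered by \<^const>\<open>pochhammer\<close>, with which it agrees
  whenever \<open>\<alpha>\<close> is not a pole of \<open>\<Gamma>\<close> (lemma \<open>pochhammer_Gamma\<close>) and which extends it
  continuously to the poles; there the series terminates if \<open>\<alpha>\<close> is a numerator parameter.
\<close>

definition hypergeo_F :: "complex \<Rightarrow> complex \<Rightarrow> complex \<Rightarrow> complex \<Rightarrow> complex" where
  "hypergeo_F a b c x =
     (\<Sum>n. pochhammer a n * pochhammer b n / (pochhammer c n * pochhammer 1 n) * x ^ n)"

lemma summable_hypergeo_F:
  fixes a b c x :: complex
  assumes x: "norm x < 1"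
  shows "summable (\<lambda>n. pochhammer a n * pochhammer b n / (pochhammer c n * pochhammer 1 n) * x ^ n)"
    (is "summable ?f")
proof -
  define q where "q n = (a + of_nat n) * (b + of_nat n) / ((c + of_nat n) * (1 + of_nat n)) * x" for n
  have step: "?f (Suc n) = q n * ?f n" for n
    by (simp add: q_def pochhammer_Suc mult_ac)
  have lin: "(\<lambda>n. z / of_nat n + 1) \<longlonglongrightarrow> 1" for z :: complex
    using tendsto_add[OF lim_const_over_n[of z] tendsto_const[of "1::complex"]] by simp
  have "(\<lambda>n. (a / of_nat n + 1) * (b / of_nat n + 1) /
          ((c / of_nat n + 1) * (1 / of_nat n + 1)) * x) \<longlonglongrightarrow> 1 * 1 / (1 * 1) * x"
    by (intro tendsto_intros lin) auto
  moreover have "\<forall>\<^sub>F n in sequentially. (a / of_nat n + 1) * (b / of_nat n + 1) /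
          ((c / of_nat n + 1) * (1 / of_nat n + 1)) * x = q n"
    using eventually_gt_at_top[of "0::nat"]
  proof eventually_elim
    case (elim n)
    have "z / of_nat n + 1 = (z + of_nat n) / of_nat n" for z :: complex
      using elim by (simp add: field_simps)
    then show ?case
      using elim by (simp add: q_def)
  qed
  ultimately have "q \<longlonglongrightarrow> x"
    by (simp add: filterlim_cong)
  then have "(\<lambda>n. norm (q n)) \<longlonglongrightarrow> norm x"
    by (rule tendsto_norm)
  moreover obtain r where r: "norm x < r" "r < 1"
    using x dense by blast
  ultimately obtain N where N: "\<And>n. n \<ge> N \<Longrightarrow> norm (q n) < r"
    by (metis (no_types, lifting) eventually_sequentially order_tendstoD(2))
  show ?thesis
  proof (rule summable_ratio_test[OF r(2)])
    fix n assume "N \<le> n"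
    then show "norm (?f (Suc n)) \<le> r * norm (?f n)"
      unfolding step norm_mult[of "q n"] using N[of n] by (intro mult_right_mono) auto
  qed
qed

end

theory Submission
  imports Defs "HOL-Complex_Analysis.Complex_Analysis"
begin

text \<open>
  Put \<open>b = 5/24 - a/4\<close>, so that the series is \<open>F(4b + 1/6, 6b; 2b + 5/6; z)\<close> at
  \<open>z\<^sub>0 = -(2 - sqrt 3)\<^sup>2\<close>. Write \<open>\<delta> = 4b - 1/3\<close>. Its Riemann scheme has exponent differences
  \<open>\<delta>/2, 2\<delta>, \<delta>/2\<close> at \<open>0, 1, \<infinity>\<close> (up to sign). That is the scheme obtained by pulling back the equation with
  differences \<open>\<delta>/2, 1/3, 1/2\<close> along a rational function \<open>R\<close> of degree six whose fibre over \<open>0\<close> is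
  \<open>0, \<infinity>\<close> and \<open>1\<close> with multiplicity four, whose points over \<open>1\<close> are all triple and whose
  points over \<open>\<infinity>\<close> are all double. With
  \<open>Q = 1 - 33z - 33z\<^sup>2 + z\<^sup>3\<close> and \<open>M = 1 + 14z + z\<^sup>2\<close> this function is
  \<open>R = -108 z (1 - z)\<^sup>4 / Q\<^sup>2 = 1 - M\<^sup>3 / Q\<^sup>2\<close>, and the pullback is the transformation

  \<open>F(4b + 1/6, 6b; 2b + 5/6; z) = Q\<^sup>-\<^sup>2\<^sup>b F(b, b + 1/2; 2b + 5/6; R(z))\<close>.

  The point \<open>z\<^sub>0\<close> is a root of \<open>M\<close>, so \<open>R(z\<^sub>0) = 1\<close> and the right-hand side is evaluated by
  Gauss's summation theorem (\<open>Gauss_summation\<close>): there \<open>c - a - b = 1/3\<close>, which is the source of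
  \<open>\<Gamma>(1/3)\<close>. The remaining two Gamma factors differ by \<open>1/2\<close> in their argument and merge by
  Legendre's duplication formula, and \<open>Q(z\<^sub>0) = 96 sqrt 3 (2 - sqrt 3)\<^sup>3\<close> supplies the powers.

  The transformation holds because both sides solve the same hypergeometric differential equation
  (\<open>pullback_ode\<close>), and such an equation has at most one solution that is holomorphic near \<open>0\<close> with
  value \<open>1\<close> there (\<open>hypergeo_ode_unique\<close>). It is continued analytically along the
  segment from \<open>0\<close> to \<open>z\<^sub>0\<close>, on which \<open>0 \<le> R < 1\<close>, and reaches the end point \<open>z\<^sub>0\<close> by continuity.
\<close>

section \<open>The hypergeometric series and its differential equation\<close>

definition hyp_coeff :: "complex \<Rightarrow> complex \<Rightarrow> complex \<Rightarrow> nat \<Rightarrow> complex" where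
  "hyp_coeff a b c n = pochhammer a n * pochhammer b n / (pochhammer c n * pochhammer 1 n)"

abbreviation hyp_fps :: "complex \<Rightarrow> complex \<Rightarrow> complex \<Rightarrow> complex fps" where
  "hyp_fps a b c \<equiv> Abs_fps (hyp_coeff a b c)"

lemma hypergeo_F_eq_eval_fps: "hypergeo_F a b c = eval_fps (hyp_fps a b c)"
  by (simp add: fun_eq_iff hypergeo_F_def eval_fps_def hyp_coeff_def)

lemma hyp_coeff_0 [simp]: "hyp_coeff a b c 0 = 1"
  by (simp add: hyp_coeff_def)

lemma hyp_coeff_Suc:
  "hyp_coeff a b c (Suc n) =
     (a + of_nat n) * (b + of_nat n) / ((c + of_nat n) * of_nat (Suc n)) * hyp_coeff a b c n"
  by (simp add: hyp_coeff_def pochhammer_Suc mult_ac)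

lemma nonpos_Ints_add_of_nat_nonzero:
  fixes c :: complex
  assumes "c \<notin> \<int>\<^sub>\<le>\<^sub>0"
  shows "c + of_nat n \<noteq> 0"
  using assms by (metis add_eq_0_iff2 add.commute minus_of_nat_in_nonpos_Ints)

lemma hyp_fps_conv_radius: "fps_conv_radius (hyp_fps a b c) \<ge> 1"
  unfolding fps_conv_radius_def
proof (rule conv_radius_geI_ex')
  fix r :: real assume "0 < r" "ereal r < 1"
  then show "summable (\<lambda>n. fps_nth (hyp_fps a b c) n * of_real r ^ n)"
    using summable_hypergeo_F[of "of_real r" a b c] by (simp add: hyp_coeff_def)
qed

lemma ball_subset_eball:
  assumes "1 \<le> r"
  shows "ball (0::complex) 1 \<subseteq> eball 0 r"
  using ball_eball_mono[of 1 r] assms by (simp add: one_ereal_def)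

lemma holomorphic_hypergeo_F: "hypergeo_F a b c holomorphic_on ball 0 1"
  unfolding hypergeo_F_eq_eval_fps
  by (intro holomorphic_on_eval_fps ball_subset_eball hyp_fps_conv_radius)

text \<open>
  The hypergeometric differential operator, acting on formal power series so that its kernel can be
  read off coefficientwise.
\<close>

definition hyp_op :: "complex \<Rightarrow> complex \<Rightarrow> complex \<Rightarrow> complex fps \<Rightarrow> complex fps" where
  "hyp_op a b c G = fps_X * (1 - fps_X) * fps_deriv (fps_deriv G) +
     (fps_const c - fps_const (a + b + 1) * fps_X) * fps_deriv G - fps_const (a * b) * G"

lemma fps_nth_hyp_op:
  "fps_nth (hyp_op a b c G) n = of_nat (Suc n) * (c + of_nat n) * fps_nth G (Suc n) -
     (a + of_nat n) * (b + of_nat n) * fps_nth G n"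
proof -
  have eq: "hyp_op a b c G = fps_X * fps_deriv (fps_deriv G) -
      fps_X * (fps_X * fps_deriv (fps_deriv G)) +
     fps_const c * fps_deriv G - fps_const (a + b + 1) * (fps_X * fps_deriv G) - fps_const (a * b) * G"
    by (simp add: hyp_op_def algebra_simps)
  show ?thesis
  proof (cases n)
    case 0
    then show ?thesis unfolding eq by simp
  next
    case (Suc m)
    then show ?thesis unfolding eq
      by (cases m) (simp_all add: fps_X_mult_nth algebra_simps)
  qed
qed

text \<open>
  The differential equation is a two-term recursion for the coefficients. Its leading factor
  \<open>(n + 1) (c + n)\<close> never vanishes, so the constant coefficient determines all others.
\<close>

lemma hyp_op_eq_0_iff:
  assumes "c \<notin> \<int>\<^sub>\<le>\<^sub>0"
  shows "hyp_op a b c G = 0 \<longleftrightarrow> G = fps_const (fps_nth G 0) * hyp_fps a b c"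
proof
  assume *: "hyp_op a b c G = 0"
  have "fps_nth G n = fps_nth G 0 * hyp_coeff a b c n" for n
  proof (induction n)
    case (Suc n)
    have "of_nat (Suc n) * (c + of_nat n) * fps_nth G (Suc n) =
          (a + of_nat n) * (b + of_nat n) * fps_nth G n"
      using fps_nth_hyp_op[of a b c G n] * by simp
    then have "fps_nth G (Suc n) = 
        (a + of_nat n) * (b + of_nat n) / ((c + of_nat n) * of_nat (Suc n)) * fps_nth G n"
      using nonpos_Ints_add_of_nat_nonzero[OF assms, of n] by (simp add: divide_simps mult_ac del: of_nat_Suc)
    then show ?case using Suc by (simp add: hyp_coeff_Suc)
  qed simp
  note G = this
  show "G = fps_const (fps_nth G 0) * hyp_fps a b c"
    by (rule fps_ext) (unfold fps_mult_left_const_nth fps_nth_Abs_fps, rule G)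
next
  assume *: "G = fps_const (fps_nth G 0) * hyp_fps a b c"
  define g where "g = fps_nth G 0"
  have G: "fps_nth G n = g * hyp_coeff a b c n" for n
    using * unfolding g_def by (metis fps_mult_left_const_nth fps_nth_Abs_fps)
  show "hyp_op a b c G = 0"
    using nonpos_Ints_add_of_nat_nonzero[OF assms]
    by (simp add: fps_eq_iff fps_nth_hyp_op G hyp_coeff_Suc del: of_nat_Suc)
qed

text \<open>
  The equation holds formally, hence near \<open>0\<close>, and extends to the unit disc by the identity theorem.
\<close>

lemma hypergeo_F_ode:
  fixes a b c :: complex
  assumes c: "c \<notin> \<int>\<^sub>\<le>\<^sub>0"
  obtains f1 f2 where
    "\<And>w. norm w < 1 \<Longrightarrow> (hypergeo_F a b c has_field_derivative f1 w) (at w)"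
    "\<And>w. norm w < 1 \<Longrightarrow> (f1 has_field_derivative f2 w) (at w)"
    "\<And>w. norm w < 1 \<Longrightarrow>
       w * (1 - w) * f2 w + (c - (a + b + 1) * w) * f1 w - a * b * hypergeo_F a b c w = 0"
proof
  let ?G = "hyp_fps a b c"
  note r0 = hyp_fps_conv_radius[of a b c]
  have r1: "fps_conv_radius (fps_deriv ?G) \<ge> 1"
    using r0 fps_conv_radius_deriv order_trans by blast
  have r2: "fps_conv_radius (fps_deriv (fps_deriv ?G)) \<ge> 1"
    using r1 fps_conv_radius_deriv order_trans by blast
  fix w :: complex assume "norm w < 1"
  then have w: "ereal (norm w) < 1" by simp
  note w' = less_le_trans[OF w]
  show "(hypergeo_F a b c has_field_derivative eval_fps (fps_deriv ?G) w) (at w)"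
    unfolding hypergeo_F_eq_eval_fps by (intro has_field_derivative_eval_fps w' r0)
  show "(eval_fps (fps_deriv ?G) has_field_derivative eval_fps (fps_deriv (fps_deriv ?G)) w) (at w)"
    by (intro has_field_derivative_eval_fps w' r1)
  let ?D = "\<lambda>w. w * (1 - w) * eval_fps (fps_deriv (fps_deriv ?G)) w +
      (c - (a + b + 1) * w) * eval_fps (fps_deriv ?G) w - a * b * eval_fps ?G w"
  have pos: "0 < r" if "r \<ge> 1" for r :: ereal
    using that by (rule less_le_trans[rotated]) simp
  have op: "hyp_op a b c ?G = 0"
    using hyp_op_eq_0_iff[OF c] by (simp add: fps_eq_iff)
  have "?D has_fps_expansion hyp_op a b c ?G"
    unfolding hyp_op_def
    by (intro fps_expansion_intros eval_fps_has_fps_expansion pos r0 r1 r2)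
  then have D: "?D has_fps_expansion 0"
    unfolding op .
  have "?D holomorphic_on ball 0 1"
    by (intro holomorphic_intros ball_subset_eball r0 r1 r2)
  from has_fps_expansion_0_analytic_continuation[OF D this]
  show "w * (1 - w) * eval_fps (fps_deriv (fps_deriv ?G)) w +
      (c - (a + b + 1) * w) * eval_fps (fps_deriv ?G) w - a * b * hypergeo_F a b c w = 0"
    unfolding hypergeo_F_eq_eval_fps using \<open>norm w < 1\<close> by simp
qed

text \<open>
  The other local solution at \<open>0\<close> has exponent \<open>1 - c\<close> and is not holomorphic there. Hence a solution
  holomorphic around \<open>0\<close> is a multiple of \<open>F\<close> there, and by analytic continuation on all of \<open>S\<close>.
\<close>

lemma hypergeo_ode_unique:
  fixes a b c :: complex
  assumes c: "c \<notin> \<int>\<^sub>\<le>\<^sub>0"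
    and S: "open S" "connected S" "0 \<in> S" "S \<subseteq> ball 0 1"
    and H1: "\<And>z. z \<in> S \<Longrightarrow> (H has_field_derivative H1 z) (at z)"
    and H2: "\<And>z. z \<in> S \<Longrightarrow> (H1 has_field_derivative H2 z) (at z)"
    and ode: "\<And>z. z \<in> S \<Longrightarrow>
       z * (1 - z) * H2 z + (c - (a + b + 1) * z) * H1 z - a * b * H z = 0"
    and z: "z \<in> S"
  shows "H z = H 0 * hypergeo_F a b c z"
proof -
  define G where "G = fps_expansion H 0"
  have hol: "H holomorphic_on S"
    using H1 S(1) holomorphic_on_open by blast
  have G: "H has_fps_expansion G"
    unfolding G_def using S hol by (intro has_fps_expansion_fps_expansion) auto
  have dH: "deriv H w = H1 w" if "w \<in> S" for w
    using H1[OF that] by (rule DERIV_imp_deriv)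
  have d2H: "deriv (deriv H) w = H2 w" if "w \<in> S" for w
  proof -
    have "(deriv H has_field_derivative H2 w) (at w)"
      using H2[OF that] has_field_derivative_transform_within_open[OF _ S(1) that] dH by metis
    then show ?thesis by (rule DERIV_imp_deriv)
  qed
  have E: "(\<lambda>z. z * (1 - z) * deriv (deriv H) z + (c - (a + b + 1) * z) * deriv H z - a * b * H z)
          has_fps_expansion hyp_op a b c G"
    unfolding hyp_op_def by (intro fps_expansion_intros G)
  have "\<forall>\<^sub>F z in nhds 0.
      z * (1 - z) * deriv (deriv H) z + (c - (a + b + 1) * z) * deriv H z - a * b * H z = 0"
    using eventually_nhds_in_open[OF S(1,3)] by eventually_elim (use ode dH d2H in auto)
  from has_fps_expansion_cong[OF this refl] E have "(\<lambda>z. 0) has_fps_expansion hyp_op a b c G"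
    by blast
  then have "hyp_op a b c G = 0"
    using fps_expansion_unique_complex has_fps_expansion_0 by blast
  then have GH: "G = fps_const (fps_nth G 0) * hyp_fps a b c"
    using hyp_op_eq_0_iff[OF c] by blast
  have G0: "fps_nth G 0 = H 0"
    using has_fps_expansion_imp_0_eq_fps_nth_0[OF G] by simp
  have F: "hypergeo_F a b c has_fps_expansion hyp_fps a b c"
    unfolding hypergeo_F_eq_eval_fps
    by (intro eval_fps_has_fps_expansion less_le_trans[OF _ hyp_fps_conv_radius]) simp
  have "(\<lambda>z. H z - H 0 * hypergeo_F a b c z) has_fps_expansion G - fps_const (H 0) * hyp_fps a b c"
    by (intro fps_expansion_intros G F)
  then have "(\<lambda>z. H z - H 0 * hypergeo_F a b c z) has_fps_expansion 0"
    using GH G0 by (metis eq_iff_diff_eq_0)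
  moreover have "(\<lambda>z. H z - H 0 * hypergeo_F a b c z) holomorphic_on S"
    by (intro holomorphic_intros hol holomorphic_on_subset[OF holomorphic_hypergeo_F S(4)])
  ultimately have "H z - H 0 * hypergeo_F a b c z = 0"
    using S z has_fps_expansion_0_analytic_continuation by blast
  then show ?thesis by simp
qed

section \<open>Gauss's summation theorem\<close>

text \<open>
  Euler's limit formula for \<open>1 / \<Gamma>\<close> gives \<open>(z, n + 1) \<approx> n! n\<^sup>z / \<Gamma>(z)\<close> for each of the four
  Pochhammer symbols.
\<close>

lemma hyp_coeff_asymptotics:
  assumes c: "c \<notin> \<int>\<^sub>\<le>\<^sub>0"
  shows "(\<lambda>n. hyp_coeff a b c (Suc n) * exp ((c + 1 - a - b) * of_real (ln (of_nat n))))
           \<longlonglongrightarrow> rGamma a * rGamma b / rGamma c"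
proof -
  have "(\<lambda>n. rGamma_series a n * rGamma_series b n / (rGamma_series c n * rGamma_series 1 n))
          \<longlonglongrightarrow> rGamma a * rGamma b / (rGamma c * rGamma 1)"
    using c by (intro tendsto_intros) (auto simp: rGamma_eq_zero_iff)
  also have "(\<lambda>n. rGamma_series a n * rGamma_series b n / (rGamma_series c n * rGamma_series 1 n)) =
    (\<lambda>n. hyp_coeff a b c (Suc n) * exp ((c + 1 - a - b) * of_real (ln (of_nat n))))"
    by (simp add: fun_eq_iff rGamma_series_def hyp_coeff_def exp_diff exp_add ring_distribs 
          left_diff_distrib divide_simps)
  finally show ?thesis by simp
qed

lemma norm_hyp_coeff_bigo:
  assumes c: "c \<notin> \<int>\<^sub>\<le>\<^sub>0"
  shows "(\<lambda>n. norm (hyp_coeff a b c (Suc n))) \<in> O(\<lambda>n. real n powr (- 1 - Re (c - a - b)))"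
proof (rule bigoI_tendsto)
  have "(\<lambda>n. norm (hyp_coeff a b c (Suc n) * exp ((c + 1 - a - b) * of_real (ln (of_nat n)))))
           \<longlonglongrightarrow> norm (rGamma a * rGamma b / rGamma c)"
    by (intro tendsto_norm hyp_coeff_asymptotics c)
  moreover have "\<forall>\<^sub>F n in sequentially.
     norm (hyp_coeff a b c (Suc n) * exp ((c + 1 - a - b) * of_real (ln (of_nat n)))) =
     norm (hyp_coeff a b c (Suc n)) / real n powr (- 1 - Re (c - a - b))"
    using eventually_gt_at_top[of "0::nat"]
    by eventually_elim (simp add: norm_mult powr_def exp_minus[symmetric] divide_inverse algebra_simps)
  ultimately show "(\<lambda>n. norm (hyp_coeff a b c (Suc n)) / real n powr (- 1 - Re (c - a - b)))
      \<longlonglongrightarrow> norm (rGamma a * rGamma b / rGamma c)"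
    by (rule Lim_transform_eventually)
  show "\<forall>\<^sub>F n in sequentially. real n powr (- 1 - Re (c - a - b)) \<noteq> 0"
    using eventually_gt_at_top[of "0::nat"] by eventually_elim auto
qed

lemma summable_norm_hyp_coeff:
  assumes "c \<notin> \<int>\<^sub>\<le>\<^sub>0" "Re (c - a - b) > 0"
  shows "summable (\<lambda>n. norm (hyp_coeff a b c n))"
proof -
  have "summable (\<lambda>n. norm (real n powr (- 1 - Re (c - a - b))))"
    using assms(2) by (simp add: summable_real_powr_iff)
  from summable_comparison_test_bigo[OF this norm_hyp_coeff_bigo[OF assms(1)]]
  show ?thesis by (rule summable_Suc_iff[THEN iffD1])
qed

lemma hyp_coeff_times_index_tendsto_0:
  assumes "c \<notin> \<int>\<^sub>\<le>\<^sub>0" "Re (c - a - b) > 0"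
  shows "(\<lambda>n. of_nat n * hyp_coeff a b c n) \<longlonglongrightarrow> 0"
proof -
  have "(\<lambda>n. real (Suc n)) \<in> O(\<lambda>n. real n)"
    by real_asymp
  from landau_o.big.mult[OF this norm_hyp_coeff_bigo[OF assms(1), of a b]]
  have "(\<lambda>n. norm (of_nat (Suc n) * hyp_coeff a b c (Suc n))) \<in> 
          O(\<lambda>n. real n * real n powr (- 1 - Re (c - a - b)))"
    by (simp add: norm_mult del: of_nat_Suc)
  moreover have "(\<lambda>n. real n * real n powr (- 1 - Re (c - a - b))) \<in> o(\<lambda>_. 1)"
    using assms(2) by real_asymp
  ultimately have "(\<lambda>n. norm (of_nat (Suc n) * hyp_coeff a b c (Suc n))) \<in> o(\<lambda>_. 1)"
    by (rule landau_o.big_small_trans)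
  then have "(\<lambda>n. norm (of_nat (Suc n) * hyp_coeff a b c (Suc n))) \<longlonglongrightarrow> 0"
    by (rule smalloD_tendsto[where g = "\<lambda>_. 1", simplified])
  then show ?thesis
    by (subst filterlim_sequentially_Suc [symmetric], rule tendsto_norm_zero_cancel)
qed

text \<open>
  The difference of the two series telescopes: its \<open>n\<close>-th term is \<open>v\<^sub>n - v\<^sub>n\<^sub>+\<^sub>1\<close> with
  \<open>v\<^sub>n = c n h\<^sub>n\<close>, where \<open>h\<^sub>n\<close> is the \<open>n\<close>-th coefficient. The boundary terms vanish because
  \<open>n h\<^sub>n\<close> tends to \<open>0\<close> under the convergence condition \<open>Re (c - a - b) > 0\<close>.
\<close>

lemma hyp_coeff_contiguous:
  assumes c: "c \<notin> \<int>\<^sub>\<le>\<^sub>0" and re: "Re (c - a - b) > 0"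
  shows "c * (c - a - b) * (\<Sum>n. hyp_coeff a b c n) =
           (c - a) * (c - b) * (\<Sum>n. hyp_coeff a b (c + 1) n)"
proof -
  have c1: "c + 1 \<notin> \<int>\<^sub>\<le>\<^sub>0"
    using c plus_one_in_nonpos_Ints_imp by blast
  have nz: "c + of_nat n \<noteq> 0" for n
    using c by (rule nonpos_Ints_add_of_nat_nonzero)
  have s: "summable (hyp_coeff a b c)" "summable (hyp_coeff a b (c + 1))"
    using summable_norm_hyp_coeff[OF c re] summable_norm_hyp_coeff[OF c1, of a b] re
    by (auto intro: summable_norm_cancel)
  have shift: "hyp_coeff a b (c + 1) n = c / (c + of_nat n) * hyp_coeff a b c n" for n
  proof -
    have "c * pochhammer (c + 1) n = (c + of_nat n) * pochhammer c n"
      by (metis pochhammer_rec pochhammer_rec')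
    moreover have "pochhammer c n \<noteq> 0" "pochhammer (c + 1) n \<noteq> 0"
      using c c1 by (auto simp: pochhammer_eq_0_iff)
    ultimately show ?thesis
      using nz[of n] by (simp add: hyp_coeff_def divide_simps)
  qed
  let ?v = "\<lambda>n. c * (of_nat n * hyp_coeff a b c n)"
  have "?v n - ?v (Suc n) = c * (c - a - b) * hyp_coeff a b c n -
           (c - a) * (c - b) * hyp_coeff a b (c + 1) n" for n
  proof -
    have v: "?v (Suc n) = c * ((a + of_nat n) * (b + of_nat n) / (c + of_nat n)) * hyp_coeff a b c n"
      unfolding hyp_coeff_Suc by (simp del: of_nat_Suc)
    show ?thesis
      unfolding v shift using nz[of n] by (simp add: divide_simps) (simp add: algebra_simps)
  qed
  moreover have "(\<lambda>n. ?v n - ?v (Suc n)) sums (?v 0 - c * 0)"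
    by (intro telescope_sums' tendsto_intros hyp_coeff_times_index_tendsto_0 c re)
  ultimately have "(\<lambda>n. c * (c - a - b) * hyp_coeff a b c n -
           (c - a) * (c - b) * hyp_coeff a b (c + 1) n) sums 0"
    by simp
  moreover have "(\<lambda>n. c * (c - a - b) * hyp_coeff a b c n -
           (c - a) * (c - b) * hyp_coeff a b (c + 1) n) sums
       (c * (c - a - b) * (\<Sum>n. hyp_coeff a b c n) -
           (c - a) * (c - b) * (\<Sum>n. hyp_coeff a b (c + 1) n))"
    by (intro sums_diff sums_mult summable_sums s)
  ultimately show ?thesis
    using sums_unique2 by fastforce
qed

lemma norm_pochhammer_le: "norm (pochhammer (z::complex) n) \<le> pochhammer (norm z) n"
proof (induction n)
  case (Suc n)
  have "norm (z + of_nat n) \<le> norm z + of_nat n"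
    by (metis norm_triangle_ineq norm_of_nat)
  moreover have "0 \<le> pochhammer (norm z) n"
    using Suc norm_ge_zero order_trans by blast
  ultimately show ?case
    using Suc by (simp add: pochhammer_Suc norm_mult mult_mono)
qed simp

lemma norm_pochhammer_nonneg: "0 \<le> pochhammer (norm (z::complex)) n"
  using norm_pochhammer_le[of z n] norm_ge_zero order_trans by blast

lemma norm_pochhammer_ge:
  assumes "0 \<le> x" "x \<le> Re z"
  shows "pochhammer x n \<le> norm (pochhammer z n)"
proof (induction n)
  case (Suc n)
  have "x + of_nat n \<le> norm (z + of_nat n)"
    using complex_Re_le_cmod[of "z + of_nat n"] assms by simp
  with Suc assms show ?case
    by (simp add: pochhammer_Suc norm_mult mult_mono)
qed simp

text \<open>
  Each term of positive index tends to \<open>0\<close> as the lower parameter \<open>c + m\<close> grows. Tannery's theorem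
  applies, since for large \<open>m\<close> the terms are dominated by those of the convergent series with
  parameters \<open>\<bar>a\<bar>, \<bar>b\<bar>\<close> and \<open>\<bar>a\<bar> + \<bar>b\<bar> + 1\<close>.
\<close>

lemma hyp_coeff_suminf_tendsto_1:
  "(\<lambda>m. \<Sum>n. hyp_coeff a b (c + of_nat m) n) \<longlonglongrightarrow> 1"
proof -
  define d where "d = norm a + norm b + 1"
  have d: "0 < d" by (simp add: d_def add_nonneg_pos)
  define M where "M n = norm (hyp_coeff (of_real (norm a)) (of_real (norm b)) (of_real d) n)" for n
  have M: "M n = pochhammer (norm a) n * pochhammer (norm b) n / (pochhammer d n * pochhammer 1 n)" for n
    using norm_pochhammer_nonneg[of a n] norm_pochhammer_nonneg[of b n] pochhammer_pos[OF d, of n]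
    unfolding M_def hyp_coeff_def
    by (simp add: norm_mult norm_divide pochhammer_of_real pochhammer_fact[symmetric])
  have "of_real d \<notin> (\<int>\<^sub>\<le>\<^sub>0 :: complex set)"
    using d by (auto elim!: nonpos_Ints_cases simp: complex_eq_iff)
  then have "summable M"
    unfolding M_def by (rule summable_norm_hyp_coeff) (simp add: d_def)
  have "\<forall>\<^sub>F m in sequentially. Re c + real m \<ge> d"
    by real_asymp
  then have bound: "\<forall>\<^sub>F m in sequentially. \<forall>n. norm (hyp_coeff a b (c + of_nat m) n) \<le> M n"
  proof eventually_elim
    case (elim m)
    show ?case
      using d elim unfolding M hyp_coeff_def
      by (auto simp: norm_mult norm_divide pochhammer_fact[symmetric] pochhammer_pos
            intro!: frac_le mult_mono norm_pochhammer_le norm_pochhammer_ge norm_pochhammer_nonneg mult_nonneg_nonneg mult_pos_pos)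
  qed
  have lim: "(\<lambda>m. hyp_coeff a b (c + of_nat m) n) \<longlonglongrightarrow> (if n = 0 then 1 else 0)" for n
  proof (induction n)
    case (Suc n)
    have "filterlim (\<lambda>m. (c + of_nat n) + of_nat m) at_infinity sequentially"
      by (intro tendsto_add_filterlim_at_infinity[OF tendsto_const] tendsto_of_nat)
    then have "(\<lambda>m. ((a + of_nat n) * (b + of_nat n) / of_nat (Suc n)) / (c + of_nat n + of_nat m)
        * hyp_coeff a b (c + of_nat m) n) \<longlonglongrightarrow> 0 * (if n = 0 then 1 else 0)"
      by (intro tendsto_mult Suc tendsto_divide_0[OF tendsto_const])
    then show ?case
      by (simp add: hyp_coeff_Suc mult_ac add_ac del: of_nat_Suc)
  qed simp
  have "(\<lambda>m. \<Sum>n. hyp_coeff a b (c + of_nat m) n) \<longlonglongrightarrow> (\<Sum>n. if n = 0 then 1 else 0)"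
  proof (rule tannerys_theorem[THEN conjunct2, THEN conjunct2])
    show "\<forall>\<^sub>F (n, m) in at_top \<times>\<^sub>F sequentially. norm (hyp_coeff a b (c + of_nat m) n) \<le> M n"
      unfolding eventually_prod_filter 
      using bound
      by (intro exI[of _ "\<lambda>_. True"] 
            exI[of _ "\<lambda>m. \<forall>n. norm (hyp_coeff a b (c + of_nat m) n) \<le> M n"]) auto
  qed (use lim \<open>summable M\<close> in auto)
  also have "(\<Sum>n::nat. if n = 0 then 1 else 0) = (1::complex)"
    by (rule sums_unique[OF sums_single[of 0 "\<lambda>_. 1"], symmetric])
  finally show ?thesis .
qed

text \<open>
  Raising \<open>c\<close> repeatedly by the contiguous relation pushes the series to its limit \<open>1\<close>, while the
  accumulated Pochhammer factors converge to Gamma factors; the powers of \<open>n\<close> in Euler's limit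
  cancel because \<open>c + (c - a - b) = (c - a) + (c - b)\<close>.
\<close>

theorem Gauss_summation:
  assumes c: "c \<notin> \<int>\<^sub>\<le>\<^sub>0" and re: "Re (c - a - b) > 0"
  shows "hypergeo_F a b c 1 = Gamma c * Gamma (c - a - b) * rGamma (c - a) * rGamma (c - b)"
proof -
  define S where "S m = (\<Sum>n. hyp_coeff a b (c + of_nat m) n)" for m
  have iter: "pochhammer c m * pochhammer (c - a - b) m * S 0 =
              pochhammer (c - a) m * pochhammer (c - b) m * S m" for m
  proof (induction m)
    case (Suc m)
    have cm: "c + of_nat m \<notin> \<int>\<^sub>\<le>\<^sub>0"
      using nonpos_Ints_add_of_nat_nonzero[OF c, of "m + k" for k]
      by (auto elim!: nonpos_Ints_cases' simp: add_ac eq_neg_iff_add_eq_0)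
    have "pochhammer c (Suc m) * pochhammer (c - a - b) (Suc m) * S 0 =
        (c + of_nat m) * (c - a - b + of_nat m) * (pochhammer (c - a) m * pochhammer (c - b) m * S m)"
      unfolding Suc[symmetric] by (simp add: pochhammer_Suc mult_ac)
    also have "\<dots> = pochhammer (c - a) m * pochhammer (c - b) m *
        ((c + of_nat m) * (c + of_nat m - a - b) * S m)"
      by (simp add: algebra_simps)
    also have "(c + of_nat m) * (c + of_nat m - a - b) * S m =
        (c + of_nat m - a) * (c + of_nat m - b) * S (Suc m)"
      unfolding S_def using hyp_coeff_contiguous[OF cm, of a b] re by (simp add: add_ac)
    finally show ?case by (simp add: pochhammer_Suc algebra_simps)
  qed simp
  have "rGamma_series c n * rGamma_series (c - a - b) n * S 0 =
        rGamma_series (c - a) n * rGamma_series (c - b) n * S (Suc n)" for n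
  proof -
    have "exp (c * of_real (ln (of_nat n))) * exp ((c - a - b) * of_real (ln (of_nat n))) =
          exp ((c - a) * of_real (ln (of_nat n))) * exp ((c - b) * of_real (ln (of_nat n)))"
      by (simp add: exp_add [symmetric] algebra_simps)
    then show ?thesis
      using iter[of "Suc n"] by (simp add: rGamma_series_def divide_simps)
  qed
  moreover have "(\<lambda>n. rGamma_series c n * rGamma_series (c - a - b) n * S 0) \<longlonglongrightarrow>
      rGamma c * rGamma (c - a - b) * S 0"
    by (intro tendsto_intros)
  moreover have "(\<lambda>n. rGamma_series (c - a) n * rGamma_series (c - b) n * S (Suc n)) \<longlonglongrightarrow>
      rGamma (c - a) * rGamma (c - b) * 1"
    using hyp_coeff_suminf_tendsto_1[of a b c] unfolding S_def[symmetric]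
    by (intro tendsto_intros LIMSEQ_Suc)
  ultimately have eq: "rGamma c * rGamma (c - a - b) * S 0 = rGamma (c - a) * rGamma (c - b)"
    using LIMSEQ_unique by fastforce
  have "c - a - b \<notin> \<int>\<^sub>\<le>\<^sub>0"
  proof
    assume "c - a - b \<in> \<int>\<^sub>\<le>\<^sub>0"
    then obtain k where "c - a - b = of_int k" "k \<le> 0"
      by (rule nonpos_Ints_cases)
    then show False
      using re unfolding \<open>c - a - b = of_int k\<close> by simp
  qed
  then have "rGamma (c - a - b) \<noteq> 0" "rGamma c \<noteq> 0"
    using c by (auto simp: rGamma_eq_zero_iff)
  with eq have "S 0 = Gamma c * Gamma (c - a - b) * rGamma (c - a) * rGamma (c - b)"
    by (simp add: rGamma_inverse_Gamma field_simps)
  moreover have "hypergeo_F a b c 1 = S 0"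
    by (simp add: hypergeo_F_def S_def hyp_coeff_def)
  ultimately show ?thesis by simp
qed

lemma continuous_on_hypergeo_F_cball:
  assumes c: "c \<notin> \<int>\<^sub>\<le>\<^sub>0" and re: "Re (c - a - b) > 0"
  shows "continuous_on (cball 0 1) (hypergeo_F a b c)"
proof -
  have "uniform_limit (cball 0 1) (\<lambda>n x. \<Sum>i<n. hyp_coeff a b c i * x ^ i) (hypergeo_F a b c) sequentially"
    unfolding hypergeo_F_def hyp_coeff_def[symmetric]
  proof (rule Weierstrass_m_test)
    show "norm (hyp_coeff a b c n * x ^ n) \<le> norm (hyp_coeff a b c n)" if "x \<in> cball 0 1" for n x
      using that power_le_one[of "norm x" n] by (simp add: norm_mult norm_power mult_left_le)
  qed (rule summable_norm_hyp_coeff[OF assms])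
  then show ?thesis
    by (rule uniform_limit_theorem[rotated]) (auto intro!: always_eventually continuous_intros)
qed

section \<open>The degree six covering\<close>

text \<open>
  These functions are used at real arguments to control signs and sizes on the segment, and at complex
  arguments for the differential equation; hence the general type.
\<close>

definition Q6 :: "'a :: real_normed_field \<Rightarrow> 'a" where
  "Q6 z = 1 - 33 * z - 33 * z\<^sup>2 + z ^ 3"

definition M6 :: "'a :: real_normed_field \<Rightarrow> 'a" where
  "M6 z = 1 + 14 * z + z\<^sup>2"

definition R6 :: "'a :: real_normed_field \<Rightarrow> 'a" where
  "R6 z = - 108 * z * (1 - z) ^ 4 / (Q6 z)\<^sup>2"

lemma of_real_Q6: "Q6 (of_real x) = of_real (Q6 x)"
  by (simp add: Q6_def)

lemma of_real_R6: "R6 (of_real x) = of_real (R6 x)"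
  by (simp add: R6_def of_real_Q6)

text \<open>
  All points over \<open>1\<close> are triple: this cancels the exponent difference \<open>1/3\<close> of the equation
  below, so that the pulled-back equation has no singularity at the roots of \<open>M6\<close>.
\<close>

lemma one_minus_R6: "Q6 z \<noteq> 0 \<Longrightarrow> 1 - R6 z = M6 z ^ 3 / (Q6 z)\<^sup>2"
  by (simp add: R6_def divide_simps) (simp add: Q6_def M6_def; algebra)

lemma DERIV_Q6 [derivative_intros]:
  "(f has_field_derivative f') (at z within A) \<Longrightarrow>
   ((\<lambda>z. Q6 (f z)) has_field_derivative (3 * (f z)\<^sup>2 - 66 * f z - 33) * f') (at z within A)"
  unfolding Q6_def
  by (auto intro!: derivative_eq_intros simp: algebra_simps power2_eq_square)

text \<open>
  The numerator consists of the ramification of the covering: order three at \<open>1\<close> and order two at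
  each root of \<open>M6\<close>.
\<close>

lemma DERIV_R6:
  assumes "Q6 z \<noteq> 0"
  shows "(R6 has_field_derivative - 108 * (1 - z) ^ 3 * (M6 z)\<^sup>2 / Q6 z ^ 3) (at z within A)"
proof -
  have alg: "(- (108 * (1 - z) ^ 4) + 432 * z * (1 - z) ^ 3) * Q6 z + 216 * z * (1 - z) ^ 4 * (3 * z\<^sup>2 - 66 * z - 33)
    = - 108 * (1 - z) ^ 3 * (M6 z)\<^sup>2"
    unfolding Q6_def M6_def by algebra
  have num: "((\<lambda>z::'a. - 108 * z * (1 - z) ^ 4) has_field_derivative
      (- (108 * (1 - z) ^ 4) + 432 * z * (1 - z) ^ 3)) (at z within A)"
    by (auto intro!: derivative_eq_intros simp: algebra_simps)
  have den: "((\<lambda>z. (Q6 z)\<^sup>2) has_field_derivative 2 * Q6 z * (3 * z\<^sup>2 - 66 * z - 33)) (at z within A)"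
    by (auto intro!: derivative_eq_intros)
  have "(R6 has_field_derivative ((- (108 * (1 - z) ^ 4) + 432 * z * (1 - z) ^ 3) * (Q6 z)\<^sup>2 -
     (- 108 * z * (1 - z) ^ 4) * (2 * Q6 z * (3 * z\<^sup>2 - 66 * z - 33))) / ((Q6 z)\<^sup>2 * (Q6 z)\<^sup>2)) (at z within A)"
    unfolding R6_def[abs_def] using assms
    by (intro DERIV_divide num den) auto
  also have "((- (108 * (1 - z) ^ 4) + 432 * z * (1 - z) ^ 3) * (Q6 z)\<^sup>2 -
     (- 108 * z * (1 - z) ^ 4) * (2 * Q6 z * (3 * z\<^sup>2 - 66 * z - 33))) / ((Q6 z)\<^sup>2 * (Q6 z)\<^sup>2) =
     ((- (108 * (1 - z) ^ 4) + 432 * z * (1 - z) ^ 3) * Q6 z + 216 * z * (1 - z) ^ 4 * (3 * z\<^sup>2 - 66 * z - 33)) / Q6 z ^ 3"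
    using assms by (simp add: divide_simps) algebra
  finally show ?thesis unfolding alg .
qed

text \<open>
  The next two identities say that the coefficients of \<open>f(R)\<close> and of \<open>f'(R)\<close> vanish when
  \<open>Q\<^sup>-\<^sup>2\<^sup>b f(R)\<close> is inserted into the equation with parameters \<open>4b + 1/6, 6b, 2b + 5/6\<close> and \<open>f''\<close> is
  eliminated; denominators are cleared by \<open>Q\<^sup>2\<close> and \<open>Q\<^sup>4\<close>, and a factor
  \<open>-108\<close> is dropped in the second.
\<close>

lemma pullback_coeff_f:
  fixes b z :: complex
  shows "z * (1 - z) * (- 2 * b * (6 * z - 66) * Q6 z + 2 * b * (2 * b + 1) * (3 * z\<^sup>2 - 66 * z - 33)\<^sup>2)
    - 108 * b * (b + 1/2) * (1 - z) ^ 3 * M6 z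
    - 2 * b * ((2 * b + 5/6) - (10 * b + 7/6) * z) * (3 * z\<^sup>2 - 66 * z - 33) * Q6 z
    - (4 * b + 1/6) * (6 * b) * (Q6 z)\<^sup>2 = 0"
  unfolding Q6_def M6_def by algebra

lemma pullback_coeff_f':
  fixes b z :: complex
  defines "N \<equiv> (1 - z) ^ 3 * (M6 z)\<^sup>2"
    and "N' \<equiv> - 3 * (1 - z)\<^sup>2 * (M6 z)\<^sup>2 + (1 - z) ^ 3 * (2 * M6 z * (14 + 2 * z))"
    and "Q' \<equiv> 3 * z\<^sup>2 - 66 * z - 33"
  shows "z * (1 - z) * (N' * Q6 z - 3 * N * Q' - 4 * b * Q' * N)
     - ((2 * b + 5/6) * (Q6 z)\<^sup>2 + (2 * b + 3/2) * (108 * z * (1 - z) ^ 4)) * (1 - z) ^ 3 * M6 z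
     + ((2 * b + 5/6) - (10 * b + 7/6) * z) * N * Q6 z = 0"
  unfolding N_def N'_def Q'_def Q6_def M6_def by algebra

text \<open>
  Here \<open>f0, f1, f2\<close> stand for \<open>f, f', f''\<close> at \<open>R6 z\<close>, the prefactor \<open>Q\<^sup>-\<^sup>2\<^sup>b\<close> is divided out, and
  \<open>-108 N / Q\<^sup>3\<close> is the derivative of \<open>R6\<close>. The second derivative can be eliminated
  without dividing by \<open>R (1 - R)\<close>, because \<open>z (1 - z) R'\<^sup>2\<close> is a multiple of it.
\<close>

lemma pullback_ode:
  fixes b z f0 f1 f2 :: complex
  defines "c \<equiv> 2 * b + 5/6"
    and "N \<equiv> (1 - z) ^ 3 * (M6 z)\<^sup>2"
    and "N' \<equiv> - 3 * (1 - z)\<^sup>2 * (M6 z)\<^sup>2 + (1 - z) ^ 3 * (2 * M6 z * (14 + 2 * z))"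
    and "Q' \<equiv> 3 * z\<^sup>2 - 66 * z - 33"
  assumes Q: "Q6 z \<noteq> 0"
    and ode: "R6 z * (1 - R6 z) * f2 + (c - (b + (b + 1/2) + 1) * R6 z) * f1 - b * (b + 1/2) * f0 = 0"
  shows "z * (1 - z) *
      (f0 * (- 2 * b * (6 * z - 66) / Q6 z + 2 * b * (2 * b + 1) * Q'\<^sup>2 / (Q6 z)\<^sup>2) +
       f1 * (- 108 * (N' / Q6 z ^ 3 - 3 * N * Q' / Q6 z ^ 4) + 432 * b * Q' * N / Q6 z ^ 4) +
       f2 * (- 108 * N / Q6 z ^ 3)\<^sup>2) +
    (c - ((4 * b + 1/6) + 6 * b + 1) * z) * (- 2 * b * Q' / Q6 z * f0 - 108 * N / Q6 z ^ 3 * f1) -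
    (4 * b + 1/6) * (6 * b) * f0 = 0" (is "?L = 0")
proof -
  define q where "q = Q6 z"
  have q: "q \<noteq> 0" using Q by (simp add: q_def)
  have "R6 z * (1 - R6 z) = - 108 * z * (1 - z) ^ 4 / q\<^sup>2 * (M6 z ^ 3 / q\<^sup>2)"
    unfolding one_minus_R6[OF Q] by (simp add: R6_def q_def)
  then have K: "z * (1 - z) * (- 108 * N / q ^ 3)\<^sup>2 = - 108 * (1 - z) ^ 3 * M6 z / q\<^sup>2 * (R6 z * (1 - R6 z))"
    using q unfolding N_def by (simp add: divide_simps) algebra
  have f2: "R6 z * (1 - R6 z) * f2 = b * (b + 1/2) * f0 - (c - (2 * b + 3/2) * R6 z) * f1"
    using ode by (simp add: algebra_simps)
  have "z * (1 - z) * (f2 * (- 108 * N / q ^ 3)\<^sup>2) =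
       - 108 * (1 - z) ^ 3 * M6 z / q\<^sup>2 * (b * (b + 1/2) * f0 - (c - (2 * b + 3/2) * R6 z) * f1)"
    unfolding f2[symmetric] using K by algebra
  also have "\<dots> = - 108 * (1 - z) ^ 3 * M6 z * b * (b + 1/2) / q\<^sup>2 * f0 +
      108 * (c * q\<^sup>2 + (2 * b + 3/2) * (108 * z * (1 - z) ^ 4)) * (1 - z) ^ 3 * M6 z / q ^ 4 * f1"
    using q unfolding R6_def q_def[symmetric] by (simp add: divide_simps) algebra
  finally have A: "z * (1 - z) * (f2 * (- 108 * N / q ^ 3)\<^sup>2) = \<dots>" .
  have "?L = (z * (1 - z) * (- 2 * b * (6 * z - 66) * q + 2 * b * (2 * b + 1) * Q'\<^sup>2)
    - 108 * b * (b + 1/2) * (1 - z) ^ 3 * M6 z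
    - 2 * b * (c - (10 * b + 7/6) * z) * Q' * q
    - (4 * b + 1/6) * (6 * b) * q\<^sup>2) / q\<^sup>2 * f0
    - 108 * (z * (1 - z) * (N' * q - 3 * N * Q' - 4 * b * Q' * N)
     - (c * q\<^sup>2 + (2 * b + 3/2) * (108 * z * (1 - z) ^ 4)) * (1 - z) ^ 3 * M6 z
     + (c - (10 * b + 7/6) * z) * N * q) / q ^ 4 * f1"
    unfolding q_def[symmetric] distrib_left[of "z * (1 - z)"] A 
    using q by (simp add: divide_simps) algebra
  also have "\<dots> = 0"
    using pullback_coeff_f[of z b] pullback_coeff_f'[of z b]
    unfolding q_def c_def N_def N'_def Q'_def by simp
  finally show ?thesis .
qed

section \<open>The sextic transformation\<close>

text \<open>
  The unit disc itself is too large: it contains the pole \<open>17 - 12 sqrt 2\<close> of \<open>R6\<close>. The condition on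
  \<open>Q6\<close> keeps the principal branch of \<open>Q\<^sup>-\<^sup>2\<^sup>b\<close> holomorphic, and the one on \<open>R6\<close> keeps the inner
  series convergent.
\<close>

definition sextic_domain :: "complex set" where
  "sextic_domain = {z \<in> ball 0 1. Re (Q6 z) > 0 \<and> norm (R6 z) < 1}"

lemma open_sextic_domain: "open sextic_domain"
proof -
  define A where "A = ball (0::complex) 1 \<inter> {z. 0 < Re (Q6 z)}"
  have cQ: "continuous_on B Q6" for B :: "complex set"
    unfolding Q6_def by (intro continuous_intros)
  have "open A"
    unfolding A_def by (intro open_Int open_ball open_Collect_less continuous_intros cQ)
  moreover have "continuous_on A (\<lambda>z. norm (R6 z))"
    unfolding R6_def A_def by (intro continuous_intros cQ) auto
  ultimately have "open ((\<lambda>z. norm (R6 z)) -` {..<1} \<inter> A)"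
    using open_lessThan continuous_on_open_vimage by blast
  moreover have "(\<lambda>z. norm (R6 z)) -` {..<1} \<inter> A = sextic_domain"
    by (auto simp: A_def sextic_domain_def)
  ultimately show ?thesis by simp
qed

lemma sextic_transformation_ode:
  fixes b :: complex
  assumes c: "2 * b + 5/6 \<notin> \<int>\<^sub>\<le>\<^sub>0"
    and S: "open S" "connected S" "0 \<in> S" "S \<subseteq> sextic_domain" and z: "z \<in> S"
  shows "hypergeo_F (4 * b + 1/6) (6 * b) (2 * b + 5/6) z =
           Q6 z powr (- 2 * b) * hypergeo_F b (b + 1/2) (2 * b + 5/6) (R6 z)"
proof -
  let ?f = "hypergeo_F b (b + 1/2) (2 * b + 5/6)"
  obtain f1 f2 where
    f1: "\<And>w. norm w < 1 \<Longrightarrow> (?f has_field_derivative f1 w) (at w)" and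
    f2: "\<And>w. norm w < 1 \<Longrightarrow> (f1 has_field_derivative f2 w) (at w)" and
    ode: "\<And>w. norm w < 1 \<Longrightarrow> w * (1 - w) * f2 w +
       ((2 * b + 5/6) - (b + (b + 1/2) + 1) * w) * f1 w - b * (b + 1/2) * ?f w = 0"
    using hypergeo_F_ode[OF c] by metis
  define P where "P z = Q6 z powr (- 2 * b)" for z
  define N where "N z = (1 - z) ^ 3 * (M6 z)\<^sup>2" for z :: complex
  define N' where "N' z = - 3 * (1 - z)\<^sup>2 * (M6 z)\<^sup>2 + (1 - z) ^ 3 * (2 * M6 z * (14 + 2 * z))" for z :: complex
  define Q' where "Q' z = 3 * z\<^sup>2 - 66 * z - 33" for z :: complex
  define H1 where "H1 z = P z * (- 2 * b * (Q' z / Q6 z) * ?f (R6 z) - 108 * (N z / Q6 z ^ 3) * f1 (R6 z))" for z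
  define H2 where "H2 z = P z *
      (?f (R6 z) * (- 2 * b * (6 * z - 66) / Q6 z + 2 * b * (2 * b + 1) * (Q' z)\<^sup>2 / (Q6 z)\<^sup>2) +
       f1 (R6 z) * (- 108 * (N' z / Q6 z ^ 3 - 3 * N z * Q' z / Q6 z ^ 4) + 432 * b * Q' z * N z / Q6 z ^ 4) +
       f2 (R6 z) * (- 108 * N z / Q6 z ^ 3)\<^sup>2)" for z
  have H: "((\<lambda>z. P z * ?f (R6 z)) has_field_derivative H1 w) (at w)"
      "(H1 has_field_derivative H2 w) (at w)"
      "w * (1 - w) * H2 w + ((2 * b + 5/6) - ((4 * b + 1/6) + 6 * b + 1) * w) * H1 w -
        (4 * b + 1/6) * (6 * b) * (P w * ?f (R6 w)) = 0" if "w \<in> S" for w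
  proof -
    have w: "0 < Re (Q6 w)" "norm (R6 w) < 1"
      using S(4) that by (auto simp: sextic_domain_def)
    have Q0: "Q6 w \<noteq> 0" and Qpos: "Q6 w \<notin> \<real>\<^sub>\<le>\<^sub>0"
      using w(1) by (auto simp: complex_nonpos_Reals_iff)
    have dQ: "(Q6 has_field_derivative Q' w) (at w)"
      unfolding Q'_def by (auto intro!: derivative_eq_intros)
    have dP: "(P has_field_derivative - 2 * b * (Q' w / Q6 w) * P w) (at w)"
      unfolding P_def[abs_def]
      by (rule DERIV_cong[OF DERIV_chain2[OF has_field_derivative_powr[OF Qpos] dQ]])
         (use Q0 in \<open>simp add: powr_diff\<close>)
    have dR: "(R6 has_field_derivative - 108 * N w / Q6 w ^ 3) (at w)"
      using DERIV_R6[OF Q0] by (simp add: N_def mult.assoc)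
    note d0 = DERIV_chain2[OF f1[OF w(2)] dR]
    note d1 = DERIV_chain2[OF f2[OF w(2)] dR]
    have dQ': "(Q' has_field_derivative 6 * w - 66) (at w)"
      unfolding Q'_def[abs_def] by (auto intro!: derivative_eq_intros)
    have dM: "(M6 has_field_derivative 14 + 2 * w) (at w)"
      unfolding M6_def[abs_def] by (auto intro!: derivative_eq_intros)
    have dN: "(N has_field_derivative N' w) (at w)"
      unfolding N_def[abs_def] N'_def
      by (auto intro!: derivative_eq_intros dM simp: algebra_simps)
    have dA: "((\<lambda>z. Q' z / Q6 z) has_field_derivative (6 * w - 66) / Q6 w - (Q' w)\<^sup>2 / (Q6 w)\<^sup>2) (at w)"
      by (rule DERIV_cong[OF DERIV_divide[OF dQ' dQ Q0]])
         (use Q0 in \<open>simp add: diff_divide_distrib power2_eq_square\<close>)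
    have dB: "((\<lambda>z. N z / Q6 z ^ 3) has_field_derivative N' w / Q6 w ^ 3 - 3 * N w * Q' w / Q6 w ^ 4) (at w)"
      by (rule DERIV_cong[OF DERIV_divide[OF dN DERIV_power[OF dQ]]])
         (use Q0 in \<open>simp_all add: divide_simps\<close>, algebra)
    show "((\<lambda>z. P z * ?f (R6 z)) has_field_derivative H1 w) (at w)"
      by (rule DERIV_cong[OF DERIV_mult[OF dP d0]]) (simp add: H1_def algebra_simps)
    show "(H1 has_field_derivative H2 w) (at w)"
      unfolding H1_def[abs_def]
      by (rule DERIV_cong[OF DERIV_mult[OF dP DERIV_diff[OF
            DERIV_mult[OF DERIV_cmult[OF dA] d0] DERIV_mult[OF DERIV_cmult[OF dB] d1]]]])
         (use Q0 in \<open>simp add: H2_def divide_simps\<close>, algebra)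
    have "w * (1 - w) * H2 w + ((2 * b + 5/6) - ((4 * b + 1/6) + 6 * b + 1) * w) * H1 w -
        (4 * b + 1/6) * (6 * b) * (P w * ?f (R6 w)) = P w * 0"
      unfolding pullback_ode[OF Q0 ode[OF w(2)], symmetric]
      unfolding H1_def H2_def N_def[symmetric] N'_def[symmetric] Q'_def[symmetric]
      by (simp add: algebra_simps)
    then show "w * (1 - w) * H2 w + ((2 * b + 5/6) - ((4 * b + 1/6) + 6 * b + 1) * w) * H1 w -
        (4 * b + 1/6) * (6 * b) * (P w * ?f (R6 w)) = 0" by simp
  qed
  have "S \<subseteq> ball 0 1"
    using S(4) by (auto simp: sextic_domain_def)
  from hypergeo_ode_unique[OF c S(1,2,3) this H z]
  have "P z * ?f (R6 z) = P 0 * ?f (R6 0) * hypergeo_F (4 * b + 1/6) (6 * b) (2 * b + 5/6) z" .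
  moreover have "P 0 * ?f (R6 0) = 1"
    by (simp add: P_def Q6_def R6_def hypergeo_F_eq_eval_fps eval_fps_at_0)
  ultimately show ?thesis by (simp add: P_def)
qed

text \<open>
  Since \<open>1 - R6 = M6\<^sup>3 / Q6\<^sup>2\<close>, the bounds on \<open>R6\<close> reduce to the sign of \<open>M6\<close>, whose roots are
  \<open>-7 \<plusminus> 4 sqrt 3\<close>.
\<close>

lemma Q6_R6_segment:
  fixes x :: real
  assumes x: "4 * sqrt 3 - 7 \<le> x" "x \<le> 0"
  shows "-1 < x" "0 < Q6 x" "0 \<le> R6 x" "R6 x \<le> 1" "4 * sqrt 3 - 7 < x \<Longrightarrow> R6 x < 1"
proof -
  have "sqrt 3 > 1.7"
    by (rule real_less_rsqrt) (simp add: power2_eq_square)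
  then have x1: "x > - 1 / 2"
    using x by simp
  then show "-1 < x" by simp
  have "33 * (- x) * (1 + x) \<ge> 0"
    using x x1 by (intro mult_nonneg_nonneg) auto
  moreover have "(- x) ^ 3 \<le> (1 / 2) ^ 3"
    using x x1 by (intro power_mono) auto
  ultimately show Q: "0 < Q6 x"
    by (simp add: Q6_def algebra_simps power2_eq_square power3_eq_cube)
  have "0 \<le> (- x) * (108 * (1 - x) ^ 4)"
    using x by (intro mult_nonneg_nonneg) auto
  then show "0 \<le> R6 x"
    unfolding R6_def by (intro divide_nonneg_nonneg) (simp_all add: mult_ac)
  have M: "M6 x = (x - (4 * sqrt 3 - 7)) * (x + 7 + 4 * sqrt 3)"
    by (simp add: M6_def algebra_simps power2_eq_square)
  have p: "x + 7 + 4 * sqrt 3 > 0"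
    using x1 \<open>sqrt 3 > 1.7\<close> by simp
  have "0 \<le> M6 x"
    unfolding M using x p by (intro mult_nonneg_nonneg) auto
  then have "0 \<le> 1 - R6 x"
    using one_minus_R6[of x] Q by simp
  then show "R6 x \<le> 1" by simp
  assume "4 * sqrt 3 - 7 < x"
  then have "0 < M6 x"
    unfolding M using p by (intro mult_pos_pos) auto
  then have "0 < 1 - R6 x"
    using one_minus_R6[of x] Q by simp
  then show "R6 x < 1" by simp
qed

text \<open>
  The domain need not be connected, so the transformation is applied on the component of \<open>0\<close>,
  which contains the whole half-open segment.
\<close>

lemma sextic_transformation_real:
  fixes b :: complex and x :: real
  assumes c: "2 * b + 5/6 \<notin> \<int>\<^sub>\<le>\<^sub>0" and x: "4 * sqrt 3 - 7 < x" "x \<le> 0"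
  shows "hypergeo_F (4 * b + 1/6) (6 * b) (2 * b + 5/6) (of_real x) =
           of_real (Q6 x) powr (- 2 * b) * hypergeo_F b (b + 1/2) (2 * b + 5/6) (of_real (R6 x))"
proof -
  define I where "I = (of_real ` {4 * sqrt 3 - 7 <.. 0} :: complex set)"
  have "I \<subseteq> sextic_domain"
    using Q6_R6_segment by (auto simp: I_def sextic_domain_def of_real_Q6 of_real_R6)
  moreover have "connected I"
    unfolding I_def by (intro connected_continuous_image continuous_intros connected_Ioc)
  moreover have "0 \<in> I"
    unfolding I_def using x by (intro image_eqI[of _ _ 0]) auto
  moreover have "of_real x \<in> I"
    unfolding I_def using x by (intro imageI) auto
  ultimately have "of_real x \<in> connected_component_set sextic_domain 0"
    using connected_component_maximal by blast
  moreover have "0 \<in> sextic_domain"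
    using \<open>0 \<in> I\<close> \<open>I \<subseteq> sextic_domain\<close> by blast
  ultimately show ?thesis
    using sextic_transformation_ode[OF c, of "connected_component_set sextic_domain 0" "of_real x"] open_sextic_domain
    by (simp add: open_connected_component connected_component_subset of_real_Q6 of_real_R6)
qed

text \<open>
  At the left end point \<open>R6 = 1\<close>, on the circle of convergence, so the equality is extended by
  continuity; the inner series is continuous up to the circle because \<open>Re (c - a - b) = 1/3 > 0\<close>.
\<close>

lemma sextic_transformation_at_endpoint:
  fixes b :: complex
  assumes c: "2 * b + 5/6 \<notin> \<int>\<^sub>\<le>\<^sub>0"
  defines "x0 \<equiv> 4 * sqrt 3 - 7"
  shows "hypergeo_F (4 * b + 1/6) (6 * b) (2 * b + 5/6) (of_real x0) =
           of_real (Q6 x0) powr (- 2 * b) * hypergeo_F b (b + 1/2) (2 * b + 5/6) (of_real (R6 x0))"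
proof -
  have x0: "x0 < 0"
  proof -
    have "sqrt 3 < 7 / 4"
      by (rule real_less_lsqrt) (simp_all add: power2_eq_square)
    then show ?thesis by (simp add: x0_def)
  qed
  let ?f = "hypergeo_F b (b + 1/2) (2 * b + 5/6)"
  let ?g = "hypergeo_F (4 * b + 1/6) (6 * b) (2 * b + 5/6)"
  define D where "D x = ?g (of_real x) - of_real (Q6 x) powr (- 2 * b) * ?f (of_real (R6 x))" for x :: real
  note seg = Q6_R6_segment[folded x0_def]
  have cQ: "continuous_on B Q6" for B :: "real set"
    unfolding Q6_def by (intro continuous_intros)
  have cR: "continuous_on {x0..0} R6"
    unfolding R6_def using seg(2) by (intro continuous_intros cQ) force
  have "continuous_on {x0..0} (\<lambda>x. ?g (of_real x))"
    by (rule continuous_on_compose2[OF holomorphic_on_imp_continuous_on[OF holomorphic_hypergeo_F]])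
       (use seg(1) in \<open>auto intro!: continuous_intros\<close>)
  moreover have "continuous_on {x0..0} (\<lambda>x. ?f (of_real (R6 x)))"
    by (rule continuous_on_compose2[OF continuous_on_hypergeo_F_cball[OF c]])
       (use seg(3,4) in \<open>auto intro!: continuous_intros cR\<close>)
  moreover have "continuous_on {x0..0} (\<lambda>x. complex_of_real (Q6 x) powr (- 2 * b))"
  proof (rule continuous_on_powr_complex)
    show "{x0..0} \<subseteq> {x. 0 \<le> Re (of_real (Q6 x)) \<or> Im (of_real (Q6 x)) \<noteq> 0}"
      using seg(2) by (auto simp: less_imp_le)
    show "0 < Re (- 2 * b)" if "x \<in> {x0..0}" "complex_of_real (Q6 x) = 0" for x
      using seg(2)[of x] that by simp
  qed (intro continuous_intros cQ)+
  ultimately have "continuous_on (closure {x0<..<0}) D"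
    unfolding D_def using x0 by (auto intro!: continuous_intros)
  moreover have "D x = 0" if "x \<in> {x0<..<0}" for x
    using that sextic_transformation_real[OF c, of x] by (simp add: D_def x0_def)
  moreover have "x0 \<in> closure {x0<..<0}"
    using x0 by simp
  ultimately have "D x0 = 0"
    by (rule continuous_constant_on_closure)
  then show ?thesis by (simp add: D_def)
qed

section \<open>Evaluation at the triple point\<close>

text \<open>
  In terms of \<open>1 / \<Gamma>\<close> the duplication formula has no exceptional points: \<open>2z\<close> is a pole of
  \<open>\<Gamma>\<close> whenever \<open>z\<close> or \<open>z + 1/2\<close> is one.
\<close>

lemma rGamma_legendre_duplication:
  fixes z :: complex
  shows "rGamma z * rGamma (z + 1/2) = exp ((2 * z - 1) * of_real (ln 2)) / of_real (sqrt pi) * rGamma (2 * z)"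
proof (cases "z \<in> \<int>\<^sub>\<le>\<^sub>0 \<or> z + 1/2 \<in> \<int>\<^sub>\<le>\<^sub>0")
  case True
  then have "2 * z \<in> \<int>\<^sub>\<le>\<^sub>0"
  proof
    assume "z \<in> \<int>\<^sub>\<le>\<^sub>0"
    then obtain n where "z = - of_nat n" by (rule nonpos_Ints_cases')
    then have "2 * z = - of_nat (2 * n)" by simp
    then show ?thesis by (metis minus_of_nat_in_nonpos_Ints)
  next
    assume "z + 1/2 \<in> \<int>\<^sub>\<le>\<^sub>0"
    then obtain n where "z + 1/2 = - of_nat n" by (rule nonpos_Ints_cases')
    have "2 * z = 2 * (z + 1/2) - 1" by simp
    also have "\<dots> = - of_nat (2 * n + 1)"
      unfolding \<open>z + 1/2 = - of_nat n\<close> by simp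
    finally have "2 * z = - of_nat (2 * n + 1)" .
    then show ?thesis by (metis minus_of_nat_in_nonpos_Ints)
  qed
  then have "rGamma (2 * z) = 0" "rGamma z * rGamma (z + 1/2) = 0"
    using True by (simp_all add: rGamma_eq_zero_iff)
  then show ?thesis by simp
next
  case False
  have "rGamma z * rGamma (z + 1/2) = inverse (Gamma z * Gamma (z + 1/2))"
    by (simp add: rGamma_inverse_Gamma)
  also have "\<dots> = inverse (exp ((1 - 2 * z) * of_real (ln 2)) * of_real (sqrt pi) * Gamma (2 * z))"
    using False Gamma_legendre_duplication[of z] by simp
  also have "\<dots> = inverse (exp ((1 - 2 * z) * of_real (ln 2))) * inverse (of_real (sqrt pi)) * rGamma (2 * z)"
    unfolding inverse_mult_distrib rGamma_inverse_Gamma ..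
  also have "inverse (exp ((1 - 2 * z) * of_real (ln 2))) = exp ((2 * z - 1) * of_real (ln 2))"
    unfolding exp_minus[symmetric] by (simp add: algebra_simps)
  finally show ?thesis by (simp only: divide_inverse)
qed

theorem mainTheorem13:
  fixes a :: complex
  assumes "5/4 - a/2 \<notin> \<int>\<^sub>\<le>\<^sub>0"
  shows "hypergeo_F (1 - a) (5/4 - 3*a/2) (5/4 - a/2) (of_real (-7 + 4 * sqrt 3)) =
           2 powr (2*a - 2) * of_real (2 - sqrt 3) powr (3*a/2 - 5/4) *
             Gamma (1/3) * Gamma (5/4 - a/2) /
           (3 powr (5/8 - 3*a/4) * of_real (sqrt pi)) * rGamma (13/12 - a/2)"
proof -
  define b where "b = 5/24 - a/4"
  define t where "t = 2 - sqrt 3"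
  define x0 where "x0 = 4 * sqrt 3 - 7"
  have params: "1 - a = 4 * b + 1/6" "5/4 - 3*a/2 = 6 * b" "5/4 - a/2 = 2 * b + 5/6" "13/12 - a/2 = 2 * b + 2/3"
    by (simp_all add: b_def field_simps)
  have c: "2 * b + 5/6 \<notin> \<int>\<^sub>\<le>\<^sub>0"
    using assms unfolding params .
  have t: "t > 0"
    unfolding t_def using real_sqrt_less_mono[of 3 4] by simp
  have s3: "sqrt 3 * sqrt 3 = (3::real)" "sqrt 3 * (sqrt 3 * y) = 3 * y" for y :: real
    by (simp_all flip: mult.assoc)
  have Q: "Q6 x0 = 2 ^ 5 * (3 * sqrt 3) * t ^ 3"
    by (simp add: Q6_def x0_def t_def power2_eq_square power3_eq_cube algebra_simps s3)
  have "M6 x0 = 0"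
    by (simp add: M6_def x0_def power2_eq_square algebra_simps s3)
  then have R: "R6 x0 = 1"
    using one_minus_R6[of x0] Q t by simp
  have "ln (p ^ 5 * (q * sqrt q) * t ^ 3) = 5 * ln p + 3/2 * ln q + 3 * ln t"
    if "p > 0" "q > 0" for p q :: real
    using that t by (simp add: ln_mult ln_realpow ln_sqrt)
  from this[of 2 3] have "ln (Q6 x0) = 5 * ln 2 + 3/2 * ln 3 + 3 * ln t"
    unfolding Q by simp
  moreover have "Q6 x0 > 0"
    unfolding Q using t by simp
  ultimately have Qpowr: "of_real (Q6 x0) powr (- 2 * b) =
     exp (- 2 * b * (5 * of_real (ln 2) + 3/2 * of_real (ln 3) + 3 * of_real (ln t)))"
    by (simp add: powr_def Ln_of_real)
  have "hypergeo_F (1 - a) (5/4 - 3*a/2) (5/4 - a/2) (of_real (-7 + 4 * sqrt 3)) =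
        of_real (Q6 x0) powr (- 2 * b) * hypergeo_F b (b + 1/2) (2 * b + 5/6) 1"
    using sextic_transformation_at_endpoint[OF c] R unfolding params x0_def by simp
  also have "hypergeo_F b (b + 1/2) (2 * b + 5/6) 1 =
       Gamma (2 * b + 5/6) * Gamma (1/3) * (rGamma (b + 1/3) * rGamma (b + 1/3 + 1/2))"
    using Gauss_summation[OF c, of b "b + 1/2"] by (simp add: algebra_simps)
  also have "rGamma (b + 1/3) * rGamma (b + 1/3 + 1/2) =
       exp ((2 * b - 1/3) * of_real (ln 2)) / of_real (sqrt pi) * rGamma (2 * b + 2/3)"
    unfolding rGamma_legendre_duplication by (simp add: algebra_simps)
  also have "of_real (Q6 x0) powr (- 2 * b) * (Gamma (2 * b + 5/6) * Gamma (1/3) *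
      (exp ((2 * b - 1/3) * of_real (ln 2)) / of_real (sqrt pi) * rGamma (2 * b + 2/3))) =
     (of_real (Q6 x0) powr (- 2 * b) * exp ((2 * b - 1/3) * of_real (ln 2))) *
      Gamma (1/3) * Gamma (2 * b + 5/6) / of_real (sqrt pi) * rGamma (2 * b + 2/3)"
    by simp
  also have "of_real (Q6 x0) powr (- 2 * b) * exp ((2 * b - 1/3) * of_real (ln 2)) =
      2 powr (2*a - 2) * of_real t powr (3*a/2 - 5/4) / 3 powr (5/8 - 3*a/4)"
  proof -
    have "2 powr (2*a - 2) = exp ((2*a - 2) * of_real (ln 2))"
         "3 powr (5/8 - 3*a/4) = exp ((5/8 - 3*a/4) * of_real (ln 3))"
         "of_real t powr (3*a/2 - 5/4) = exp ((3*a/2 - 5/4) * of_real (ln t))"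
      using t Ln_of_real[of 2] Ln_of_real[of 3] by (simp_all add: powr_def Ln_of_real)
    then show ?thesis
      unfolding Qpowr by (simp add: b_def algebra_simps flip: exp_add exp_diff)
  qed
  finally show ?thesis
    unfolding params t_def[symmetric] by (simp add: mult_ac)
qed

end
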